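(* Let $\Delta$ be a reduced root system, $\Pi$ a basis of $\Delta$, $\Delta^+$ the corresponding set of positive roots, and $\Gamma$ the stem of $\Delta^+$. Then $\Gamma$ is a maximal (with respect to inclusion) strongly orthogonal subset of $\Delta^+$.
   Context: For $\gamma\in\Delta^+$ put $\Phi_\gamma^+=\{\alpha\in\Delta^+ \mid \gamma-\alpha\in\Delta^+\}$. The stem of $\Delta^+$ is the unique subset $\Gamma\subset\Delta^+$ such that $\Delta^+=\Gamma\cup\bigcup_{\gamma\in\Gamma}\Phi_\gamma^+$ as a disjoint union (existence and uniqueness are known). Two roots $\alpha,\beta\in\Delta$ are strongly orthogonal if $\alpha+\beta\notin\Delta$ and $\alpha-\beta\notin\Delta$; a subset of $\Delta^+$ is strongly orthogonal if any two distinct elements of it are strongly orthogonal. *)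

theory Defs
  imports "HOL-Analysis.Analysis"
begin

text \<open>Root systems are crystallographic and live in a finite-dimensional real inner product
  space \<open>V\<close>, given as the span of the finite set \<open>R\<close> inside an ambient inner product space.
  Using a subspace rather than the whole type also covers the empty root system.\<close>

definition root_reflection :: "'a::real_inner \<Rightarrow> 'a \<Rightarrow> 'a" where
  "root_reflection \<alpha> x = x - (2 * (x \<bullet> \<alpha>) / (\<alpha> \<bullet> \<alpha>)) *\<^sub>R \<alpha>"

definition root_system :: "'a::real_inner set \<Rightarrow> 'a set \<Rightarrow> bool" where
  "root_system V R \<longleftrightarrow>
     finite R \<and> 0 \<notin> R \<and> span R = V \<and>
     (\<forall>\<alpha>\<in>R. root_reflection \<alpha> ` R = R) \<and>
     (\<forall>\<alpha>\<in>R. \<forall>\<beta>\<in>R. 2 * (\<beta> \<bullet> \<alpha>) / (\<alpha> \<bullet> \<alpha>) \<in> \<int>)"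

definition reduced_root_system :: "'a::real_inner set \<Rightarrow> 'a set \<Rightarrow> bool" where
  "reduced_root_system V R \<longleftrightarrow>
     root_system V R \<and> (\<forall>\<alpha>\<in>R. \<forall>c::real. c *\<^sub>R \<alpha> \<in> R \<longrightarrow> c = 1 \<or> c = -1)"

definition nat_combinations :: "'a::real_vector set \<Rightarrow> 'a set" where
  "nat_combinations B = {x. \<exists>c::'a \<Rightarrow> nat. x = (\<Sum>b\<in>B. real (c b) *\<^sub>R b)}"

definition root_basis :: "'a::real_inner set \<Rightarrow> 'a set \<Rightarrow> 'a set \<Rightarrow> bool" where
  "root_basis V R B \<longleftrightarrow>
     B \<subseteq> R \<and> independent B \<and> span B = V \<and>
     (\<forall>\<alpha>\<in>R. \<alpha> \<in> nat_combinations B \<or> - \<alpha> \<in> nat_combinations B)"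

definition positive_roots :: "'a::real_inner set \<Rightarrow> 'a set \<Rightarrow> 'a set" where
  "positive_roots R B = R \<inter> nat_combinations B"

definition Phi_plus :: "'a::real_inner set \<Rightarrow> 'a \<Rightarrow> 'a set" where
  "Phi_plus P \<gamma> = {\<alpha> \<in> P. \<gamma> - \<alpha> \<in> P}"

text \<open>The stem is given by its defining property, which determines it uniquely when \<open>P\<close> is
  the set of positive roots of a reduced root system. The union being disjoint means that all
  the pieces, \<open>\<Gamma>\<close> and the \<open>Phi_plus P \<gamma>\<close> for \<open>\<gamma> \<in> \<Gamma>\<close>, are pairwise disjoint.\<close>

definition is_stem :: "'a::real_inner set \<Rightarrow> 'a set \<Rightarrow> bool" where
  "is_stem P \<Gamma> \<longleftrightarrow>
     \<Gamma> \<subseteq> P \<and>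
     P = \<Gamma> \<union> (\<Union>\<gamma>\<in>\<Gamma>. Phi_plus P \<gamma>) \<and>
     (\<forall>\<gamma>\<in>\<Gamma>. \<Gamma> \<inter> Phi_plus P \<gamma> = {}) \<and>
     disjoint_family_on (Phi_plus P) \<Gamma>"

definition strongly_orthogonal :: "'a::real_inner set \<Rightarrow> 'a \<Rightarrow> 'a \<Rightarrow> bool" where
  "strongly_orthogonal R \<alpha> \<beta> \<longleftrightarrow> \<alpha> + \<beta> \<notin> R \<and> \<alpha> - \<beta> \<notin> R"

definition strongly_orthogonal_subset :: "'a::real_inner set \<Rightarrow> 'a set \<Rightarrow> 'a set \<Rightarrow> bool" where
  "strongly_orthogonal_subset R P S \<longleftrightarrow> S \<subseteq> P \<and> pairwise (strongly_orthogonal R) S"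

definition maximal_strongly_orthogonal_subset ::
    "'a::real_inner set \<Rightarrow> 'a set \<Rightarrow> 'a set \<Rightarrow> bool" where
  "maximal_strongly_orthogonal_subset R P S \<longleftrightarrow>
     strongly_orthogonal_subset R P S \<and>
     (\<forall>T. strongly_orthogonal_subset R P T \<longrightarrow> S \<subseteq> T \<longrightarrow> T = S)"

end

theory Submission
  imports Defs
begin

text \<open>Distinct elements of the stem cannot differ by a root, as one would then lie in the
  \<open>Phi_plus\<close> of the other. If \<open>\<gamma> + \<delta>\<close> were a root for \<open>\<gamma>, \<delta> \<in> \<Gamma>\<close>, then \<open>\<gamma> + \<delta> + \<beta> = \<epsilon>\<close> for
  some \<open>\<epsilon> \<in> \<Gamma>\<close> and positive \<open>\<beta>\<close>. Here \<open>\<epsilon> - \<gamma> = \<delta> + \<beta>\<close> and \<open>\<epsilon> - \<delta> = \<gamma> + \<beta>\<close> are neither zero nor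
  roots, so \<open>\<epsilon>\<close> has nonpositive and \<open>\<beta>\<close> nonnegative inner product with \<open>\<gamma>\<close> and with \<open>\<delta>\<close>; this
  contradicts \<open>\<epsilon> \<bullet> (\<gamma> + \<delta>) = (\<gamma> + \<delta>) \<bullet> (\<gamma> + \<delta>) + \<beta> \<bullet> (\<gamma> + \<delta>)\<close>. Maximality is immediate: a positive
  root outside \<open>\<Gamma>\<close> lies in some \<open>Phi_plus P \<gamma>\<close>, hence differs from \<open>\<gamma>\<close> by a root.\<close>

lemma root_reflection_in_roots:
  assumes "root_system V R" "\<alpha> \<in> R" "\<beta> \<in> R"
  shows "root_reflection \<alpha> \<beta> \<in> R"
  using assms unfolding root_system_def by blast

lemma uminus_in_roots:
  assumes "root_system V R" "\<alpha> \<in> R"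
  shows "- \<alpha> \<in> R"
proof -
  have "\<alpha> \<bullet> \<alpha> \<noteq> 0"
    using assms unfolding root_system_def by auto
  then have "root_reflection \<alpha> \<alpha> = - \<alpha>"
    by (simp add: root_reflection_def scaleR_2)
  then show ?thesis
    using root_reflection_in_roots[OF assms(1,2,2)] by simp
qed

text \<open>Both Cartan integers \<open>m a b\<close> and \<open>m b a\<close> are positive. If
  neither were 1, both would be at least 2, so \<open>a \<bullet> b\<close> would bound both squared
  norms and \<open>a - b\<close> would have nonpositive squared norm.\<close>

lemma diff_in_roots_of_inner_pos:
  assumes R: "root_system V R" and a: "a \<in> R" and b: "b \<in> R"
    and pos: "a \<bullet> b > 0" and ne: "a \<noteq> b"
  shows "a - b \<in> R"
proof -
  define m where "m x y = 2 * (x \<bullet> y) / (y \<bullet> y)" for x y :: 'a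
  have one_or_ge: "m x y = 1 \<or> x \<bullet> y \<ge> y \<bullet> y" if "x \<in> R" "y \<in> R" "x \<bullet> y > 0" for x y
  proof -
    have yy: "y \<bullet> y > 0"
      using R that unfolding root_system_def by auto
    have "m x y \<in> \<int>"
      using R that unfolding root_system_def m_def by blast
    then obtain k :: int where k: "m x y = of_int k"
      by (auto elim: Ints_cases)
    have "m x y > 0"
      using that yy by (simp add: m_def)
    then have "k = 1 \<or> k \<ge> 2"
      using k by auto
    then show ?thesis
    proof
      assume "k \<ge> 2"
      then have "2 * (y \<bullet> y) \<le> of_int k * (y \<bullet> y)"
        using yy by (intro mult_right_mono) auto
      also have "\<dots> = 2 * (x \<bullet> y)"
        using yy k by (simp add: m_def field_simps)
      finally show ?thesis
        by simp
    qed (use k in simp)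
  qed
  \<comment> \<open>When the Cartan integer is 1, the reflection in \<open>y\<close> sends
    \<open>x\<close> to \<open>x - y\<close>.\<close>
  have diff: "x - y \<in> R" if "x \<in> R" "y \<in> R" "m x y = 1" for x y
    using root_reflection_in_roots[OF R that(2,1)] that(3)
    unfolding root_reflection_def m_def by (metis scaleR_one)
  have "m a b = 1 \<or> m b a = 1"
  proof (rule ccontr)
    assume "\<not> ?thesis"
    then have "a \<bullet> b \<ge> b \<bullet> b" "a \<bullet> b \<ge> a \<bullet> a"
      using one_or_ge[OF a b pos] one_or_ge[OF b a] pos by (auto simp: inner_commute)
    then have "(a - b) \<bullet> (a - b) \<le> 0"
      by (simp add: inner_diff_left inner_diff_right inner_commute)
    then have "a - b = 0"
      using inner_ge_zero[of "a - b"] inner_eq_zero_iff[of "a - b"] by linarith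
    then show False
      using ne by simp
  qed
  then show ?thesis
    using diff[OF a b] uminus_in_roots[OF R diff[OF b a]] by auto
qed

lemma add_in_roots_of_inner_neg:
  assumes "root_system V R" "a \<in> R" "b \<in> R" "a \<bullet> b < 0" "a + b \<noteq> 0"
  shows "a + b \<in> R"
  using diff_in_roots_of_inner_pos[of V R a "- b"] assms uminus_in_roots[of V R b]
  by (simp add: add_eq_0_iff2)

lemma nat_combinations_add:
  assumes "x \<in> nat_combinations B" "y \<in> nat_combinations B"
  shows "x + y \<in> nat_combinations B"
proof -
  obtain c d where "x = (\<Sum>b\<in>B. real (c b) *\<^sub>R b)" "y = (\<Sum>b\<in>B. real (d b) *\<^sub>R b)"
    using assms unfolding nat_combinations_def by blast
  then have "x + y = (\<Sum>b\<in>B. real (c b + d b) *\<^sub>R b)"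
    by (simp add: sum.distrib scaleR_add_left)
  then show ?thesis
    unfolding nat_combinations_def by (auto intro!: exI[of _ "\<lambda>b. c b + d b"])
qed

text \<open>Independence makes the coefficient sums vanish, and natural numbers cannot cancel. Hence
  two positive roots never sum to zero.\<close>

lemma nat_combinations_add_eq_zero:
  assumes "finite B" "independent B"
    and "x \<in> nat_combinations B" "y \<in> nat_combinations B" "x + y = 0"
  shows "x = 0"
proof -
  obtain c d where c: "x = (\<Sum>b\<in>B. real (c b) *\<^sub>R b)" and d: "y = (\<Sum>b\<in>B. real (d b) *\<^sub>R b)"
    using assms unfolding nat_combinations_def by blast
  have "(\<Sum>b\<in>B. (real (c b) + real (d b)) *\<^sub>R b) = 0"
    using assms(5) unfolding c d by (simp add: sum.distrib scaleR_add_left)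
  then have "real (c b) + real (d b) = 0" if "b \<in> B" for b
    using independentD[OF assms(2,1) subset_refl _ that, of "\<lambda>b. real (c b) + real (d b)"]
    by simp
  then have "c b = 0" if "b \<in> B" for b
    using that by (metis of_nat_add add_is_0 of_nat_eq_0_iff)
  then show ?thesis
    unfolding c by simp
qed

theorem corollary2p20:
  fixes V \<Delta> B \<Gamma> :: "'a::real_inner set"
  assumes "reduced_root_system V \<Delta>"
    and "root_basis V \<Delta> B"
    and "is_stem (positive_roots \<Delta> B) \<Gamma>"
  shows "maximal_strongly_orthogonal_subset \<Delta> (positive_roots \<Delta> B) \<Gamma>"
proof -
  define P where "P = positive_roots \<Delta> B"
  have R: "root_system V \<Delta>"
    using assms(1) unfolding reduced_root_system_def by blast
  have B: "B \<subseteq> \<Delta>" "independent B"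
    using assms(2) unfolding root_basis_def by blast+
  have "finite B" and zero: "0 \<notin> \<Delta>"
    using R B unfolding root_system_def by (auto intro: finite_subset)
  have P_sub: "P \<subseteq> \<Delta>"
    by (auto simp: P_def positive_roots_def)
  have P_or: "x \<in> P \<or> - x \<in> P" if "x \<in> \<Delta>" for x
    using that assms(2) uminus_in_roots[OF R that]
    unfolding P_def positive_roots_def root_basis_def by blast
  have P_add: "x + y \<in> P" if "x \<in> P" "y \<in> P" "x + y \<in> \<Delta>" for x y
    using that nat_combinations_add unfolding P_def positive_roots_def by blast
  have P_add_nz: "x + y \<noteq> 0" if "x \<in> P" "y \<in> P" for x y
    using that nat_combinations_add_eq_zero[OF \<open>finite B\<close> B(2)] zero
    unfolding P_def positive_roots_def by blast
  have \<Gamma>P: "\<Gamma> \<subseteq> P"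
    using assms(3) unfolding is_stem_def P_def[symmetric] by blast
  have cover: "\<exists>\<gamma>\<in>\<Gamma>. \<gamma> - x \<in> P" if "x \<in> P" "x \<notin> \<Gamma>" for x
    using assms(3) that unfolding is_stem_def P_def[symmetric] Phi_plus_def by blast
  have sep: "\<gamma> - \<delta> \<notin> P" if "\<gamma> \<in> \<Gamma>" "\<delta> \<in> \<Gamma>" for \<gamma> \<delta>
    using assms(3) that \<Gamma>P unfolding is_stem_def P_def[symmetric] Phi_plus_def by blast
  \<comment> \<open>The vector \<open>\<epsilon> - \<gamma> = \<delta> + \<beta>\<close> is nonzero
    as a sum of positive roots. Were it a root, it would be positive, against \<open>sep\<close>.
    Read as a difference it bounds \<open>\<epsilon> \<bullet> \<gamma>\<close>, read as a sum
    \<open>\<beta> \<bullet> \<delta>\<close>.\<close>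
  have signs: "\<epsilon> \<bullet> \<gamma> \<le> 0 \<and> \<beta> \<bullet> \<delta> \<ge> 0"
    if "\<epsilon> \<in> \<Gamma>" "\<gamma> \<in> \<Gamma>" "\<delta> \<in> \<Gamma>" "\<beta> \<in> P" and eq: "\<epsilon> - \<gamma> = \<delta> + \<beta>" for \<epsilon> \<gamma> \<delta> \<beta>
  proof -
    have mem: "\<epsilon> \<in> \<Delta>" "\<gamma> \<in> \<Delta>" "\<delta> \<in> P" "\<delta> \<in> \<Delta>" "\<beta> \<in> \<Delta>"
      using that \<Gamma>P P_sub by blast+
    have nz: "\<delta> + \<beta> \<noteq> 0"
      using P_add_nz mem(3) that(4) .
    have "\<delta> + \<beta> \<notin> \<Delta>"
      using P_add[OF mem(3) that(4)] sep[OF that(1,2)] eq by auto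
    then show ?thesis
      using diff_in_roots_of_inner_pos[OF R mem(1,2)] nz eq
        add_in_roots_of_inner_neg[OF R mem(4,5)]
      by (metis inner_commute not_le right_minus_eq)
  qed
  \<comment> \<open>The argument also covers \<open>\<gamma> = \<delta>\<close>, so distinctness is
    not assumed.\<close>
  have "strongly_orthogonal \<Delta> \<gamma> \<delta>" if "\<gamma> \<in> \<Gamma>" "\<delta> \<in> \<Gamma>" for \<gamma> \<delta>
    unfolding strongly_orthogonal_def
  proof
    show "\<gamma> - \<delta> \<notin> \<Delta>"
      using P_or[of "\<gamma> - \<delta>"] sep that by auto
    show "\<gamma> + \<delta> \<notin> \<Delta>"
    proof
      assume sum: "\<gamma> + \<delta> \<in> \<Delta>"
      have mem: "\<gamma> \<in> P" "\<delta> \<in> P"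
        using that \<Gamma>P by auto
      \<comment> \<open>Otherwise \<open>\<gamma> + \<delta>\<close> and \<open>\<gamma>\<close>
        would be stem elements whose difference \<open>\<delta>\<close> is a positive root.\<close>
      have "\<gamma> + \<delta> \<notin> \<Gamma>"
        using sep[of "\<gamma> + \<delta>" \<gamma>] that mem by auto
      then obtain \<epsilon> where \<epsilon>: "\<epsilon> \<in> \<Gamma>" "\<epsilon> - (\<gamma> + \<delta>) \<in> P"
        using cover P_add[OF mem sum] by blast
      define \<beta> where "\<beta> = \<epsilon> - (\<gamma> + \<delta>)"
      \<comment> \<open>\<open>signs\<close> is used twice, the second time with
        \<open>\<gamma>\<close> and \<open>\<delta>\<close> exchanged.\<close>
      have "\<epsilon> \<bullet> \<gamma> \<le> 0 \<and> \<beta> \<bullet> \<delta> \<ge> 0" "\<epsilon> \<bullet> \<delta> \<le> 0 \<and> \<beta> \<bullet> \<gamma> \<ge> 0"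
        using signs \<epsilon> that by (auto simp: \<beta>_def)
      then have "(\<gamma> + \<delta>) \<bullet> (\<gamma> + \<delta>) \<le> 0"
        by (simp add: \<beta>_def inner_add_left inner_add_right inner_diff_left)
      then have "\<gamma> + \<delta> = 0"
        using inner_gt_zero_iff[of "\<gamma> + \<delta>"] by linarith
      then show False
        using sum zero by simp
    qed
  qed
  then have "strongly_orthogonal_subset \<Delta> P \<Gamma>"
    using \<Gamma>P by (simp add: strongly_orthogonal_subset_def pairwise_def)
  moreover have "T = \<Gamma>" if T: "strongly_orthogonal_subset \<Delta> P T" "\<Gamma> \<subseteq> T" for T
  proof (rule ccontr)
    assume "T \<noteq> \<Gamma>"
    then obtain x where x: "x \<in> T" "x \<notin> \<Gamma>"
      using T(2) by blast
    moreover have "x \<in> P"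
      using x T(1) unfolding strongly_orthogonal_subset_def by blast
    ultimately obtain \<gamma> where \<gamma>: "\<gamma> \<in> \<Gamma>" "\<gamma> - x \<in> P"
      using cover by blast
    then have "strongly_orthogonal \<Delta> \<gamma> x"
      using T x pairwiseD[of "strongly_orthogonal \<Delta>" T \<gamma> x]
      unfolding strongly_orthogonal_subset_def by auto
    then show False
      using \<gamma>(2) P_sub unfolding strongly_orthogonal_def by auto
  qed
  ultimately show ?thesis
    unfolding maximal_strongly_orthogonal_subset_def P_def by blast
qed

end
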